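(* Let $\Sigma$ be a compact oriented connected surface of genus $g\ge3$ with zero or one boundary component. For every admissible presentation datum $\mathcal P$ for $\Sigma$, the candidate algebra $\mathcal A(\overline{\Gamma(\Sigma)};\mathcal P)=F/R_{\mathcal P}$ admits a character, i.e. a unital $\mathbb Q(A)$-algebra homomorphism $$\varepsilon_{\mathrm{aug}}\colon\mathcal A(\overline{\Gamma(\Sigma)};\mathcal P)\longrightarrow\mathbb Q(A),$$ that sends every quotient generator $[X_i]$ to $0$.
   Context: **Coefficients.** $A$ is an indeterminate and $\mathbb Q(A)$ is the field of rational functions in $A$ over $\mathbb Q$. A character of a unital $\mathbb Q(A)$-algebra $B$ is a unital $\mathbb Q(A)$-algebra homomorphism $B\to\mathbb Q(A)$. **Surface and mapping class group.** A boundary component is an actual boundary circle of the compact surface (no punctures, no marked points). $\Gamma(\Sigma)=\pi_0(\mathrm{Homeo}^+(\Sigma,\partial\Sigma))$ is the group of isotopy classes of orientation-preserving homeomorphisms fixing $\partial\Sigma$ pointwise, with isotopies relative to $\partial\Sigma$. $Z(G)$ denotes the center of a group $G$, and $\overline{\Gamma(\Sigma)}=\Gamma(\Sigma)/Z(\Gamma(\Sigma))$. For simple closed curves $\alpha,\beta\subset\Sigma$, $\iota(\alpha,\beta)$ is the geometric intersection number. $t_\alpha$ is the right Dehn twist about $\alpha$: in an orientation-preserving annular chart $S^1\times[0,1]$ around $\alpha$ (with $S^1\times[0,1]$ oriented as a planar annulus via $(e^{i\theta},r)\mapsto(1+r)e^{i\theta}$) it is $(e^{i\theta},r)\mapsto(e^{i(\theta-2\pi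 r)},r)$, and it is the identity elsewhere; thus an arc crossing $\alpha$ is turned to the right. **Admissible presentation datum $\mathcal P$.** It consists of: 1. a finite family $\{\gamma_i\}_{i\in I}$, $I=\{1,\dots,N\}$, of nonseparating simple closed curves on $\Sigma$, any two of which intersect at most once, and whose Dehn twists generate $\Gamma(\Sigma)$. Write $t_i=t_{\gamma_i}$, and also $t_i$ for its image in $\overline{\Gamma(\Sigma)}$; 2. a presentation, with $K\ge1$, $$\overline{\Gamma(\Sigma)}=\langle t_1,\dots,t_N\mid R_1(t_1,\dots,t_N)=\cdots=R_K(t_1,\dots,t_N)=1\rangle,$$ each $R_\ell$ being a word in the letters $t_j^{\pm1}$. **Candidate algebra.** Let $F=\mathbb Q(A)\langle X_i:i\in I\rangle$ be the free associative noncommutative (unital) $\mathbb Q(A)$-algebra. For $j\in I$ and $\epsilon\in\{+1,-1\}$ let $T_{j,\epsilon}\colon F\to F$ be the algebra endomorphism with $$T_{j,\epsilon}(X_k)=\begin{cases}X_k,&\iota(\gamma_j,\gamma_k)=0,\\ \epsilon\,(A^{\epsilon}X_jX_k-A^{-\epsilon}X_kX_j),&\iota(\gamma_j,\gamma_k)=1.\end{cases}$$ Put $T_{j,+}=T_{j,+1}$, $T_{j,-}=T_{j,-1}$, $T_j=T_{j,+}$. $R_\ell(T_1,\dots,T_N)$ is the endomorphism of $F$ obtained by replacing each letter $t_j$ by $T_{j,+}$ and each letter $t_j^{-1}$ by $T_{j,-}$ in the word $R_\ell$, read as a composition with the rightmost factor acting first. Let $R_{\mathcal P}\subset F$ be the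 two-sided ideal generated by: - $R_\ell(T_1,\dots,T_N)(X_i)-X_i$ for $1\le i\le N$, $1\le\ell\le K$; - $T_{j,+}(T_{j,-}(X_i))-X_i$ for $1\le i,j\le N$; - $X_iX_j-X_jX_i$ whenever $\iota(\gamma_i,\gamma_j)=0$. The Santharoubane candidate algebra is $\mathcal A(\overline{\Gamma(\Sigma)};\mathcal P)=F/R_{\mathcal P}$, and $[X_i]$ is the class of $X_i$ in it. *)

theory Defs
  imports
    "HOL-Analysis.Analysis"
    "HOL-Complex_Analysis.Winding_Numbers"
    "HOL-Computational_Algebra.Polynomial"
    "HOL-Computational_Algebra.Fraction_Field"
    "HOL-Library.Poly_Mapping"
    "HOL-Algebra.QuotRing"
    "HOL-Algebra.Module"
    "HOL-Algebra.Generated_Groups"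
    "HOL-Algebra.Algebraic_Closure_Type"
begin

section \<open>Oriented topological surfaces with boundary\<close>

definition plane_chart :: "'a topology \<Rightarrow> 'a set \<Rightarrow> ('a \<Rightarrow> complex) \<Rightarrow> bool" where
  "plane_chart S U \<phi> \<longleftrightarrow>
     openin S U \<and> open (\<phi> ` U) \<and>
     homeomorphic_map (subtopology S U) (top_of_set (\<phi> ` U)) \<phi>"

definition half_plane_chart :: "'a topology \<Rightarrow> 'a set \<Rightarrow> ('a \<Rightarrow> complex) \<Rightarrow> bool" where
  "half_plane_chart S U \<phi> \<longleftrightarrow>
     openin S U \<and> openin (top_of_set {z. 0 \<le> Im z}) (\<phi> ` U) \<and>
     homeomorphic_map (subtopology S U) (top_of_set (\<phi> ` U)) \<phi>"

text \<open>Second countability is not listed: it is automatic for the compact surfaces considered.\<close>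

definition surface :: "'a topology \<Rightarrow> bool" where
  "surface S \<longleftrightarrow>
     Hausdorff_space S \<and> (\<forall>p\<in>topspace S. \<exists>U \<phi>. p \<in> U \<and> half_plane_chart S U \<phi>)"

definition surface_interior :: "'a topology \<Rightarrow> 'a set" where
  "surface_interior S = {p \<in> topspace S. \<exists>U \<phi>. p \<in> U \<and> plane_chart S U \<phi>}"

definition surface_boundary :: "'a topology \<Rightarrow> 'a set" where
  "surface_boundary S = topspace S - surface_interior S"

definition boundary_components :: "'a topology \<Rightarrow> 'a set set" where
  "boundary_components S = connected_components_of (subtopology S (surface_boundary S))"

text \<open>
  For a homeomorphism between open sets of the plane, preserving the orientation at a point means
  that a small positively oriented circle around the point is mapped to a curve of winding
  number 1 (rather than -1).
\<close>

definition orientation_preserving_at :: "(complex \<Rightarrow> complex) \<Rightarrow> complex \<Rightarrow> bool" where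
  "orientation_preserving_at f z \<longleftrightarrow>
     (\<forall>\<^sub>F r in at_right 0. winding_number (f \<circ> circlepath z r) (f z) = 1)"

text \<open>
  An orientation of a surface is given by an oriented atlas of its interior; charts are pairs of a
  domain and a coordinate map.
\<close>

type_synonym 'a atlas = "('a set \<times> ('a \<Rightarrow> complex)) set"

definition orientation :: "'a topology \<Rightarrow> 'a atlas \<Rightarrow> bool" where
  "orientation S Or \<longleftrightarrow>
     (\<forall>(U, \<phi>)\<in>Or. plane_chart S U \<phi>) \<and>
     (\<Union>(U, \<phi>)\<in>Or. U) = surface_interior S \<and>
     (\<forall>(U, \<phi>)\<in>Or. \<forall>(V, \<psi>)\<in>Or. \<forall>p\<in>U \<inter> V.
        orientation_preserving_at (\<psi> \<circ> inv_into U \<phi>) (\<phi> p))"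

section \<open>Simple closed curves, genus and intersection numbers\<close>

abbreviation unit_circle :: "complex topology" where
  "unit_circle \<equiv> top_of_set (sphere 0 1)"

definition curve_embedding :: "'a topology \<Rightarrow> (complex \<Rightarrow> 'a) \<Rightarrow> bool" where
  "curve_embedding S c \<longleftrightarrow>
     embedding_map unit_circle S c \<and> c ` sphere 0 1 \<subseteq> surface_interior S"

text \<open>As usual, curves are unoriented and lie in the interior of the surface.\<close>

definition simple_closed_curve :: "'a topology \<Rightarrow> 'a set \<Rightarrow> bool" where
  "simple_closed_curve S \<alpha> \<longleftrightarrow> (\<exists>c. curve_embedding S c \<and> \<alpha> = c ` sphere 0 1)"

definition nonseparating :: "'a topology \<Rightarrow> 'a set \<Rightarrow> bool" where
  "nonseparating S \<alpha> \<longleftrightarrow> connectedin S (topspace S - \<alpha>)"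

definition isotopic_curves :: "'a topology \<Rightarrow> 'a set \<Rightarrow> 'a set \<Rightarrow> bool" where
  "isotopic_curves S \<alpha> \<beta> \<longleftrightarrow>
     (\<exists>c d. \<alpha> = c ` sphere 0 1 \<and> \<beta> = d ` sphere 0 1 \<and>
            homotopic_with (curve_embedding S) unit_circle S c d)"

text \<open>
  The finiteness condition is essential, as infinite sets have cardinality 0 by convention.
\<close>

definition geometric_intersection :: "'a topology \<Rightarrow> 'a set \<Rightarrow> 'a set \<Rightarrow> nat" where
  "geometric_intersection S \<alpha> \<beta> =
     (LEAST n. \<exists>a b. isotopic_curves S \<alpha> a \<and> isotopic_curves S \<beta> b \<and>
                     finite (a \<inter> b) \<and> card (a \<inter> b) = n)"

text \<open>
  The genus is the largest number of pairwise disjoint simple closed curves in the interior whose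
  union does not disconnect the surface.
\<close>

definition nonseparating_system :: "'a topology \<Rightarrow> 'a set set \<Rightarrow> bool" where
  "nonseparating_system S C \<longleftrightarrow>
     finite C \<and> (\<forall>\<alpha>\<in>C. simple_closed_curve S \<alpha>) \<and> pairwise disjnt C \<and>
     connectedin S (topspace S - \<Union>C)"

definition genus :: "'a topology \<Rightarrow> nat" where
  "genus S = (GREATEST n. \<exists>C. nonseparating_system S C \<and> card C = n)"

section \<open>The mapping class group\<close>

text \<open>
  Homeomorphisms are extended by the identity outside the space, so that equality of
  homeomorphisms is equality of functions.
\<close>

definition Homeo :: "'a topology \<Rightarrow> 'a atlas \<Rightarrow> ('a \<Rightarrow> 'a) set" where
  "Homeo S Or =
     {h. homeomorphic_map S S h \<and>
         (\<forall>x\<in>surface_boundary S. h x = x) \<and>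
         (\<forall>x. x \<notin> topspace S \<longrightarrow> h x = x) \<and>
         (\<forall>(U, \<phi>)\<in>Or. \<forall>(V, \<psi>)\<in>Or. \<forall>p\<in>U. h p \<in> V \<longrightarrow>
            orientation_preserving_at (\<psi> \<circ> h \<circ> inv_into U \<phi>) (\<phi> p))}"

text \<open>
  All stages of the homotopy belong to \<^const>\<open>Homeo\<close>; hence this is isotopy relative to the
  boundary.
\<close>

definition isotopy_rel :: "'a topology \<Rightarrow> 'a atlas \<Rightarrow> (('a \<Rightarrow> 'a) \<times> ('a \<Rightarrow> 'a)) set" where
  "isotopy_rel S Or = {(h, k). homotopic_with (\<lambda>f. f \<in> Homeo S Or) S S h k}"

definition isotopy_class :: "'a topology \<Rightarrow> 'a atlas \<Rightarrow> ('a \<Rightarrow> 'a) \<Rightarrow> ('a \<Rightarrow> 'a) set" where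
  "isotopy_class S Or h = isotopy_rel S Or `` {h}"

definition MCG :: "'a topology \<Rightarrow> 'a atlas \<Rightarrow> ('a \<Rightarrow> 'a) set monoid" where
  "MCG S Or =
     \<lparr>carrier = Homeo S Or // isotopy_rel S Or,
      mult = (\<lambda>a b. \<Union>h\<in>a. \<Union>k\<in>b. isotopy_class S Or (h \<circ> k)),
      one = isotopy_class S Or id\<rparr>"

definition center :: "('a, 'b) monoid_scheme \<Rightarrow> 'a set" where
  "center G = {z \<in> carrier G. \<forall>x\<in>carrier G. z \<otimes>\<^bsub>G\<^esub> x = x \<otimes>\<^bsub>G\<^esub> z}"

definition MCG_bar :: "'a topology \<Rightarrow> 'a atlas \<Rightarrow> ('a \<Rightarrow> 'a) set set monoid" where
  "MCG_bar S Or = MCG S Or Mod center (MCG S Or)"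

section \<open>Right Dehn twists\<close>

text \<open>
  The annulus is taken in its planar form, \<open>(exp (i \<theta>), r)\<close> corresponding to the point
  \<open>(1 + r) exp (i \<theta>)\<close>. Under this identification \<open>twist_map\<close> is
  \<open>(exp (i \<theta>), r) \<mapsto> (exp (i (\<theta> - 2 \<pi> r)), r)\<close>.
\<close>

definition annulus :: "complex set" where
  "annulus = {z. 1 \<le> norm z \<and> norm z \<le> 2}"

definition twist_map :: "complex \<Rightarrow> complex" where
  "twist_map z = z * cis (- 2 * pi * (norm z - 1))"

definition annular_chart :: "'a topology \<Rightarrow> 'a atlas \<Rightarrow> 'a set \<Rightarrow> (complex \<Rightarrow> 'a) \<Rightarrow> bool" where
  "annular_chart S Or \<alpha> e \<longleftrightarrow>
     embedding_map (top_of_set annulus) S e \<and>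
     e ` sphere 0 (3/2) = \<alpha> \<and>
     (\<forall>z\<in>interior annulus. \<forall>(U, \<phi>)\<in>Or. e z \<in> U \<longrightarrow> orientation_preserving_at (\<phi> \<circ> e) z)"

definition is_dehn_twist :: "'a topology \<Rightarrow> 'a atlas \<Rightarrow> 'a set \<Rightarrow> ('a \<Rightarrow> 'a) \<Rightarrow> bool" where
  "is_dehn_twist S Or \<alpha> h \<longleftrightarrow>
     (\<exists>e. annular_chart S Or \<alpha> e \<and>
          (\<forall>z\<in>annulus. h (e z) = e (twist_map z)) \<and>
          (\<forall>x. x \<notin> e ` annulus \<longrightarrow> h x = x))"

text \<open>The mapping class of the Dehn twists about a curve; it does not depend on the chart.\<close>

definition dehn_twist :: "'a topology \<Rightarrow> 'a atlas \<Rightarrow> 'a set \<Rightarrow> ('a \<Rightarrow> 'a) set" where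
  "dehn_twist S Or \<alpha> = (\<Union>h\<in>{h. is_dehn_twist S Or \<alpha> h}. isotopy_class S Or h)"

section \<open>Group presentations\<close>

text \<open>
  The letter \<open>(j, \<epsilon>)\<close> with \<open>\<epsilon>\<close> in \<open>{1, -1}\<close> stands for the \<open>\<epsilon>\<close>-th power of the \<open>j\<close>-th generator.
\<close>

type_synonym gword = "(nat \<times> int) list"

definition gwords :: "nat \<Rightarrow> gword set" where
  "gwords N = lists ({1..N} \<times> {1, -1})"

inductive word_cong :: "nat \<Rightarrow> gword set \<Rightarrow> gword \<Rightarrow> gword \<Rightarrow> bool" for N Rels where
  refl: "u \<in> gwords N \<Longrightarrow> word_cong N Rels u u"
| sym: "word_cong N Rels u v \<Longrightarrow> word_cong N Rels v u"
| trans: "word_cong N Rels u v \<Longrightarrow> word_cong N Rels v w \<Longrightarrow> word_cong N Rels u w"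
| cancel: "u \<in> gwords N \<Longrightarrow> v \<in> gwords N \<Longrightarrow> j \<in> {1..N} \<Longrightarrow> \<epsilon> \<in> {1, -1} \<Longrightarrow>
    word_cong N Rels (u @ [(j, \<epsilon>), (j, - \<epsilon>)] @ v) (u @ v)"
| relator: "u \<in> gwords N \<Longrightarrow> v \<in> gwords N \<Longrightarrow> r \<in> gwords N \<Longrightarrow> r \<in> Rels \<Longrightarrow>
    word_cong N Rels (u @ r @ v) (u @ v)"

definition word_class :: "nat \<Rightarrow> gword set \<Rightarrow> gword \<Rightarrow> gword set" where
  "word_class N Rels u = {v. word_cong N Rels u v}"

definition presented_group :: "nat \<Rightarrow> gword set \<Rightarrow> gword set monoid" where
  "presented_group N Rels =
     \<lparr>carrier = word_class N Rels ` gwords N,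
      mult = (\<lambda>a b. \<Union>u\<in>a. \<Union>v\<in>b. word_class N Rels (u @ v)),
      one = word_class N Rels []\<rparr>"

definition has_presentation ::
  "('a, 'b) monoid_scheme \<Rightarrow> nat \<Rightarrow> (nat \<Rightarrow> 'a) \<Rightarrow> gword set \<Rightarrow> bool" where
  "has_presentation G N t Rels \<longleftrightarrow>
     (\<exists>f \<in> iso (presented_group N Rels) G. \<forall>j\<in>{1..N}. f (word_class N Rels [(j, 1)]) = t j)"

section \<open>Admissible presentation data\<close>

record 'a presentation_datum =
  num_curves :: nat
  the_curve :: "nat \<Rightarrow> 'a set"
  num_relators :: nat
  the_relator :: "nat \<Rightarrow> gword"

definition admissible :: "'a topology \<Rightarrow> 'a atlas \<Rightarrow> 'a presentation_datum \<Rightarrow> bool" where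
  "admissible S Or P \<longleftrightarrow>
     (let N = num_curves P; K = num_relators P; \<gamma> = the_curve P; R = the_relator P;
          t = (\<lambda>i. dehn_twist S Or (\<gamma> i))
      in (\<forall>i\<in>{1..N}. simple_closed_curve S (\<gamma> i) \<and> nonseparating S (\<gamma> i)) \<and>
         (\<forall>i\<in>{1..N}. \<forall>j\<in>{1..N}. geometric_intersection S (\<gamma> i) (\<gamma> j) \<le> 1) \<and>
         generate (MCG S Or) (t ` {1..N}) = carrier (MCG S Or) \<and>
         1 \<le> K \<and>
         (\<forall>l\<in>{1..K}. R l \<in> gwords N) \<and>
         has_presentation (MCG_bar S Or) N
           (\<lambda>i. center (MCG S Or) #>\<^bsub>MCG S Or\<^esub> t i) (R ` {1..K}))"

section \<open>The free algebra over the field of rational functions\<close>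

type_synonym ratfun = "rat poly fract"

definition indet :: ratfun where
  "indet = Fraction_Field.Fract [:0, 1:] 1"

text \<open>
  The free monoid, written additively so that \<open>\<Rightarrow>\<^sub>0\<close> with the convolution product is the
  (noncommutative) monoid algebra.
\<close>

datatype 'i free_monoid = FM (letters: "'i list")

instantiation free_monoid :: (type) monoid_add
begin
definition zero_free_monoid :: "'a free_monoid" where "0 = FM []"
definition plus_free_monoid :: "'a free_monoid \<Rightarrow> 'a free_monoid \<Rightarrow> 'a free_monoid" where
  "u + v = FM (letters u @ letters v)"
instance
  by standard (simp_all add: zero_free_monoid_def plus_free_monoid_def)
end

type_synonym ncpoly = "nat free_monoid \<Rightarrow>\<^sub>0 ratfun"

definition scal :: "ratfun \<Rightarrow> ncpoly" where
  "scal c = Poly_Mapping.single 0 c"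

definition Xgen :: "nat \<Rightarrow> ncpoly" where
  "Xgen i = Poly_Mapping.single (FM [i]) 1"

definition free_algebra :: "nat \<Rightarrow> (ratfun, ncpoly) module" where
  "free_algebra N =
     \<lparr>carrier = {f. \<forall>w\<in>Poly_Mapping.keys f. set (letters w) \<subseteq> {1..N}},
      mult = (*), one = 1, zero = 0, add = (+), smult = (\<lambda>c f. scal c * f)\<rparr>"

text \<open>The algebra endomorphism with prescribed values \<open>\<sigma> i\<close> on the generators.\<close>

definition free_hom :: "(nat \<Rightarrow> ncpoly) \<Rightarrow> ncpoly \<Rightarrow> ncpoly" where
  "free_hom \<sigma> f =
     (\<Sum>w\<in>Poly_Mapping.keys f. scal (Poly_Mapping.lookup f w) * prod_list (map \<sigma> (letters w)))"

section \<open>The candidate algebra\<close>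

text \<open>
  Below \<open>\<iota>\<close> is the matrix of intersection numbers of the curves of the datum; for an admissible
  datum its entries are 0 or 1.
\<close>

definition T :: "(nat \<Rightarrow> nat \<Rightarrow> nat) \<Rightarrow> nat \<Rightarrow> int \<Rightarrow> ncpoly \<Rightarrow> ncpoly" where
  "T \<iota> j \<epsilon> = free_hom (\<lambda>k.
     if \<iota> j k = 0 then Xgen k
     else scal (of_int \<epsilon>) *
          (scal (indet powi \<epsilon>) * Xgen j * Xgen k - scal (indet powi (- \<epsilon>)) * Xgen k * Xgen j))"

definition T_word :: "(nat \<Rightarrow> nat \<Rightarrow> nat) \<Rightarrow> gword \<Rightarrow> ncpoly \<Rightarrow> ncpoly" where
  "T_word \<iota> w = foldr (\<lambda>(j, \<epsilon>) f. T \<iota> j \<epsilon> \<circ> f) w id"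

definition curve_matrix :: "'a topology \<Rightarrow> 'a presentation_datum \<Rightarrow> nat \<Rightarrow> nat \<Rightarrow> nat" where
  "curve_matrix S P i j = geometric_intersection S (the_curve P i) (the_curve P j)"

definition relation_ideal :: "'a topology \<Rightarrow> 'a presentation_datum \<Rightarrow> ncpoly set" where
  "relation_ideal S P =
     (let N = num_curves P; K = num_relators P; R = the_relator P; \<iota> = curve_matrix S P
      in genideal (free_algebra N)
          ({T_word \<iota> (R l) (Xgen i) - Xgen i | i l. i \<in> {1..N} \<and> l \<in> {1..K}} \<union>
           {T \<iota> j 1 (T \<iota> j (-1) (Xgen i)) - Xgen i | i j. i \<in> {1..N} \<and> j \<in> {1..N}} \<union>
           {Xgen i * Xgen j - Xgen j * Xgen i | i j. i \<in> {1..N} \<and> j \<in> {1..N} \<and> \<iota> i j = 0}))"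

text \<open>The quotient ring with the induced scalar multiplication, in the style of \<^const>\<open>FactRing\<close>.\<close>

definition quotient_algebra :: "('k, 'b) module \<Rightarrow> 'b set \<Rightarrow> ('k, 'b set) module" where
  "quotient_algebra M I =
     \<lparr>carrier = carrier (M Quot I), mult = mult (M Quot I), one = one (M Quot I),
      zero = zero (M Quot I), add = add (M Quot I),
      smult = (\<lambda>c a. \<Union>x\<in>a. I +>\<^bsub>M\<^esub> (c \<odot>\<^bsub>M\<^esub> x))\<rparr>"

definition candidate_algebra ::
  "'a topology \<Rightarrow> 'a presentation_datum \<Rightarrow> (ratfun, ncpoly set) module" where
  "candidate_algebra S P = quotient_algebra (free_algebra (num_curves P)) (relation_ideal S P)"

definition generator_class :: "'a topology \<Rightarrow> 'a presentation_datum \<Rightarrow> nat \<Rightarrow> ncpoly set" where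
  "generator_class S P i = relation_ideal S P +>\<^bsub>free_algebra (num_curves P)\<^esub> Xgen i"

text \<open>Recall that the elements of \<^const>\<open>ring_hom\<close> are unital.\<close>

definition is_character :: "(ratfun, 'b) module \<Rightarrow> ('b \<Rightarrow> ratfun) \<Rightarrow> bool" where
  "is_character B f \<longleftrightarrow>
     f \<in> ring_hom B (ring_of_type_algebra :: ratfun ring) \<and>
     (\<forall>c. \<forall>x\<in>carrier B. f (c \<odot>\<^bsub>B\<^esub> x) = c * f x)"

end

theory Submission
  imports Defs
begin

text \<open>
  Why the theorem is true: every element of the free algebra has a constant term, and taking it is
  a unital algebra homomorphism \<open>F \<rightarrow> \<rat>(A)\<close> with \<open>X\<^sub>i \<mapsto> 0\<close>. It descends to the candidate algebra
  as soon as it annihilates the generators of the relation ideal. Each \<open>T\<^sub>j\<^sub>,\<^sub>\<epsilon>\<close> sends each \<open>X\<^sub>k\<close> to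
  \<open>X\<^sub>k\<close> or to a quadratic expression, that is, to an element without constant term; hence \<open>T\<^sub>j\<^sub>,\<^sub>\<epsilon>\<close>,
  and with it every composite of such maps, preserves constant terms. Whichever words the
  relators are, \<open>R\<^sub>l(T)(X\<^sub>i)\<close>, \<open>T\<^sub>j\<^sub>,\<^sub>+(T\<^sub>j\<^sub>,\<^sub>-(X\<^sub>i))\<close> and \<open>X\<^sub>i\<close> all have constant term 0
  (\<open>lookup_0_T_word\<close>), and a commutator of two generators has too.

  A generated ideal is an intersection of ideals contained in \<open>F\<close>, and an intersection over no
  ideals at all is not an ideal. So one also checks that the listed elements lie in the subalgebra
  \<open>F\<close> spanned by the words in \<open>X\<^sub>1, \<dots>, X\<^sub>N\<close>, and not merely in the algebra on all the \<open>X\<^sub>k\<close>; this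
  holds because the relators are words in the letters \<open>1, \<dots>, N\<close> (\<open>T_word_closed\<close>).
\<close>

section \<open>Constant terms in the free algebra\<close>

text \<open>The empty word factors only as a product of empty words, so constant terms multiply.\<close>

lemma lookup_0_mult_free_monoid:
  fixes f g :: "'i free_monoid \<Rightarrow>\<^sub>0 'a::semiring_0"
  shows "Poly_Mapping.lookup (f * g) 0 = Poly_Mapping.lookup f 0 * Poly_Mapping.lookup g 0"
proof -
  have "u + v = 0 \<longleftrightarrow> u = 0 \<and> v = 0" for u v :: "'i free_monoid"
    by (cases u; cases v) (simp add: plus_free_monoid_def zero_free_monoid_def)
  then have inner: "(\<Sum>q. (Poly_Mapping.lookup g q when 0 = l + q)) =
      (Poly_Mapping.lookup g 0 when l = 0)" for l :: "'i free_monoid"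
    by (cases "l = 0") (simp_all add: eq_commute[of 0])
  have outer: "Poly_Mapping.lookup f l * (Poly_Mapping.lookup g 0 when l = 0) =
      (Poly_Mapping.lookup f l * Poly_Mapping.lookup g 0 when l = 0)" for l
    by (cases "l = 0") simp_all
  show ?thesis
    unfolding lookup_mult inner outer by simp
qed

lemma lookup_0_scal [simp]: "Poly_Mapping.lookup (scal c) 0 = c"
  by (simp add: scal_def)

lemma lookup_0_Xgen [simp]: "Poly_Mapping.lookup (Xgen i) 0 = 0"
  by (simp add: Xgen_def lookup_single zero_free_monoid_def)

lemma lookup_0_free_hom:
  assumes "\<And>k. Poly_Mapping.lookup (\<sigma> k) 0 = 0"
  shows "Poly_Mapping.lookup (free_hom \<sigma> f) 0 = Poly_Mapping.lookup f 0"
proof -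
  have words: "Poly_Mapping.lookup (prod_list (map \<sigma> (letters w))) 0 = (if w = 0 then 1 else 0)" for w
  proof (cases w)
    case (FM ks)
    then show ?thesis
      by (cases ks)
        (simp_all add: lookup_0_mult_free_monoid assms, simp_all add: zero_free_monoid_def)
  qed
  have "Poly_Mapping.lookup (free_hom \<sigma> f) 0 =
      (\<Sum>w\<in>Poly_Mapping.keys f. if w = 0 then Poly_Mapping.lookup f w else 0)"
    by (simp add: free_hom_def lookup_sum lookup_0_mult_free_monoid words if_distrib cong: if_cong)
  then show ?thesis
    by (simp add: in_keys_iff)
qed

lemma lookup_0_T: "Poly_Mapping.lookup (T \<iota> j \<epsilon> f) 0 = Poly_Mapping.lookup f 0"
  unfolding T_def
  by (rule lookup_0_free_hom) (simp add: lookup_0_mult_free_monoid lookup_minus)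

lemma lookup_0_T_word: "Poly_Mapping.lookup (T_word \<iota> w f) 0 = Poly_Mapping.lookup f 0"
  unfolding T_word_def by (induction w) (auto simp: lookup_0_T)

section \<open>The free algebra as a subring of all noncommutative polynomials\<close>

lemma mult_closed_free_algebra:
  assumes "f \<in> carrier (free_algebra N)" and "g \<in> carrier (free_algebra N)"
  shows "f * g \<in> carrier (free_algebra N)"
proof -
  have "set (letters w) \<subseteq> {1..N}" if "w \<in> Poly_Mapping.keys (f * g)" for w
  proof -
    obtain u v where "w = u + v" "u \<in> Poly_Mapping.keys f" "v \<in> Poly_Mapping.keys g"
      using keys_mult[of f g] \<open>w \<in> Poly_Mapping.keys (f * g)\<close> by blast
    then show ?thesis
      using assms by (auto simp: free_algebra_def plus_free_monoid_def)
  qed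
  then show ?thesis
    by (simp add: free_algebra_def)
qed

lemma add_closed_free_algebra:
  assumes "f \<in> carrier (free_algebra N)" and "g \<in> carrier (free_algebra N)"
  shows "f + g \<in> carrier (free_algebra N)"
  using assms Poly_Mapping.keys_add[of f g] by (auto simp: free_algebra_def)

lemma uminus_closed_free_algebra:
  "f \<in> carrier (free_algebra N) \<Longrightarrow> - f \<in> carrier (free_algebra N)"
  by (simp add: free_algebra_def)

lemma diff_closed_free_algebra:
  assumes "f \<in> carrier (free_algebra N)" and "g \<in> carrier (free_algebra N)"
  shows "f - g \<in> carrier (free_algebra N)"
  using add_closed_free_algebra[OF assms(1) uminus_closed_free_algebra[OF assms(2)]] by simp

lemma scal_closed: "scal c \<in> carrier (free_algebra N)"
  by (simp add: free_algebra_def scal_def zero_free_monoid_def)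

lemma Xgen_closed: "i \<in> {1..N} \<Longrightarrow> Xgen i \<in> carrier (free_algebra N)"
  by (simp add: free_algebra_def Xgen_def)

lemma zero_closed_free_algebra: "0 \<in> carrier (free_algebra N)"
  by (simp add: free_algebra_def)

lemma one_closed_free_algebra: "1 \<in> carrier (free_algebra N)"
  by (simp add: free_algebra_def zero_free_monoid_def)

lemmas free_algebra_closed =
  mult_closed_free_algebra add_closed_free_algebra uminus_closed_free_algebra
  diff_closed_free_algebra scal_closed Xgen_closed zero_closed_free_algebra
  one_closed_free_algebra

lemma free_algebra_ops [simp]:
  "mult (free_algebra N) = (*)" "one (free_algebra N) = 1" "zero (free_algebra N) = 0"
  "add (free_algebra N) = (+)" "module.smult (free_algebra N) = (\<lambda>c f. scal c * f)"
  by (simp_all add: free_algebra_def)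

lemma ring_free_algebra: "ring (free_algebra N)"
proof (rule ringI)
  show "abelian_group (free_algebra N)"
  proof (rule abelian_groupI)
    fix f assume "f \<in> carrier (free_algebra N)"
    then show "\<exists>g\<in>carrier (free_algebra N). g \<oplus>\<^bsub>free_algebra N\<^esub> f = \<zero>\<^bsub>free_algebra N\<^esub>"
      by (intro bexI[of _ "- f"]) (simp_all add: free_algebra_closed)
  qed (simp_all add: free_algebra_closed add_ac)
  show "monoid (free_algebra N)"
    by (rule monoidI) (simp_all add: free_algebra_closed mult.assoc)
qed (simp_all add: algebra_simps)

lemma free_hom_closed:
  assumes "\<And>k. k \<in> {1..N} \<Longrightarrow> \<sigma> k \<in> carrier (free_algebra N)"
    and "f \<in> carrier (free_algebra N)"
  shows "free_hom \<sigma> f \<in> carrier (free_algebra N)"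
proof -
  have words: "prod_list (map \<sigma> ks) \<in> carrier (free_algebra N)" if "set ks \<subseteq> {1..N}" for ks
    using that by (induction ks) (simp_all add: assms(1) free_algebra_closed)
  have sums: "(\<Sum>w\<in>W. h w) \<in> carrier (free_algebra N)"
    if "\<And>w. w \<in> W \<Longrightarrow> h w \<in> carrier (free_algebra N)" for W and h :: "nat free_monoid \<Rightarrow> ncpoly"
    using that by (induction W rule: infinite_finite_induct) (simp_all add: free_algebra_closed)
  show ?thesis
    unfolding free_hom_def
  proof (rule sums)
    fix w assume "w \<in> Poly_Mapping.keys f"
    then have "set (letters w) \<subseteq> {1..N}"
      using assms(2) by (simp add: free_algebra_def)
    then show "scal (Poly_Mapping.lookup f w) * prod_list (map \<sigma> (letters w))
        \<in> carrier (free_algebra N)"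
      by (intro mult_closed_free_algebra scal_closed words)
  qed
qed

lemma T_closed:
  assumes "j \<in> {1..N}" and "f \<in> carrier (free_algebra N)"
  shows "T \<iota> j \<epsilon> f \<in> carrier (free_algebra N)"
  unfolding T_def
proof (rule free_hom_closed)
  fix k assume "k \<in> {1..N}"
  then show "(if \<iota> j k = 0 then Xgen k
     else scal (of_int \<epsilon>) *
          (scal (indet powi \<epsilon>) * Xgen j * Xgen k - scal (indet powi (- \<epsilon>)) * Xgen k * Xgen j))
      \<in> carrier (free_algebra N)"
    using assms(1)
    by (auto intro!: mult_closed_free_algebra diff_closed_free_algebra scal_closed Xgen_closed)
qed (rule assms(2))

lemma T_word_closed:
  assumes "w \<in> gwords N" and "f \<in> carrier (free_algebra N)"
  shows "T_word \<iota> w f \<in> carrier (free_algebra N)"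
  using assms(1) unfolding gwords_def T_word_def
  by (induction w) (auto simp: assms(2) intro!: T_closed)

section \<open>Homomorphisms on quotient algebras\<close>

text \<open>
  The induced map evaluates a homomorphism on any representative. Scalars act on a coset through
  all of its representatives at once, which is harmless because the homomorphism has the same value
  on all of them.
\<close>

lemma character_of_quotient_algebra:
  fixes M :: "(ratfun, 'b) module"
  assumes I: "ideal I M"
    and h: "h \<in> ring_hom M (ring_of_type_algebra :: ratfun ring)"
    and vanish: "\<And>x. x \<in> I \<Longrightarrow> h x = 0"
    and smult_closed: "\<And>c x. x \<in> carrier M \<Longrightarrow> c \<odot>\<^bsub>M\<^esub> x \<in> carrier M"
    and smult: "\<And>c x. x \<in> carrier M \<Longrightarrow> h (c \<odot>\<^bsub>M\<^esub> x) = c * h x"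
  obtains \<epsilon> where "is_character (quotient_algebra M I) \<epsilon>"
    and "\<And>x. x \<in> carrier M \<Longrightarrow> \<epsilon> (I +>\<^bsub>M\<^esub> x) = h x"
proof
  interpret ideal I M by (rule I)
  define \<epsilon> where "\<epsilon> a = the_elem (h ` a)" for a
  have h_add: "h (x \<oplus>\<^bsub>M\<^esub> y) = h x + h y" and h_mult: "h (x \<otimes>\<^bsub>M\<^esub> y) = h x * h y"
    if "x \<in> carrier M" "y \<in> carrier M" for x y
    using ring_hom_add[OF h that] ring_hom_mult[OF h that]
    by (simp_all add: ring_of_type_algebra_def)
  have h_one: "h \<one>\<^bsub>M\<^esub> = 1"
    using ring_hom_one[OF h] by (simp add: ring_of_type_algebra_def)
  have coset_subset: "y \<in> carrier M" if "x \<in> carrier M" "y \<in> I +>\<^bsub>M\<^esub> x" for x y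
    using that a_Hcarr by (auto simp: a_r_coset_def')
  have const: "h y = h x" if "x \<in> carrier M" "y \<in> I +>\<^bsub>M\<^esub> x" for x y
    using that a_Hcarr by (auto simp: a_r_coset_def' h_add vanish)
  have self: "x \<in> I +>\<^bsub>M\<^esub> x" if "x \<in> carrier M" for x
    using that by (rule a_rcos_self)
  have image: "h ` (I +>\<^bsub>M\<^esub> x) = {h x}" if "x \<in> carrier M" for x
    using const[OF that] self[OF that] by blast
  show eval: "\<epsilon> (I +>\<^bsub>M\<^esub> x) = h x" if "x \<in> carrier M" for x
    by (simp add: \<epsilon>_def image[OF that])
  have cosets: "\<exists>x\<in>carrier M. a = I +>\<^bsub>M\<^esub> x" if "a \<in> carrier (quotient_algebra M I)" for a
    using that by (auto simp: quotient_algebra_def FactRing_def A_RCOSETS_def')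
  have hom: "\<epsilon> \<in> ring_hom (quotient_algebra M I) (ring_of_type_algebra :: ratfun ring)"
  proof (rule ring_hom_memI)
    fix a b assume "a \<in> carrier (quotient_algebra M I)" "b \<in> carrier (quotient_algebra M I)"
    then obtain x y where x: "x \<in> carrier M" "a = I +>\<^bsub>M\<^esub> x" and y: "y \<in> carrier M" "b = I +>\<^bsub>M\<^esub> y"
      using cosets by blast
    have "a \<otimes>\<^bsub>quotient_algebra M I\<^esub> b = I +>\<^bsub>M\<^esub> (x \<otimes>\<^bsub>M\<^esub> y)"
      using x y by (simp add: quotient_algebra_def FactRing_def rcoset_mult_add)
    then show "\<epsilon> (a \<otimes>\<^bsub>quotient_algebra M I\<^esub> b) = \<epsilon> a \<otimes>\<^bsub>ring_of_type_algebra\<^esub> \<epsilon> b"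
      using x y by (simp add: eval h_mult ring_of_type_algebra_def)
    have "a \<oplus>\<^bsub>quotient_algebra M I\<^esub> b = I +>\<^bsub>M\<^esub> (x \<oplus>\<^bsub>M\<^esub> y)"
      using x y by (simp add: quotient_algebra_def FactRing_def a_rcos_sum)
    then show "\<epsilon> (a \<oplus>\<^bsub>quotient_algebra M I\<^esub> b) = \<epsilon> a \<oplus>\<^bsub>ring_of_type_algebra\<^esub> \<epsilon> b"
      using x y by (simp add: eval h_add ring_of_type_algebra_def)
  next
    show "\<epsilon> \<one>\<^bsub>quotient_algebra M I\<^esub> = \<one>\<^bsub>ring_of_type_algebra\<^esub>"
      by (simp add: quotient_algebra_def FactRing_def eval h_one ring_of_type_algebra_def)
  qed (simp add: ring_of_type_algebra_def)
  have "\<epsilon> (c \<odot>\<^bsub>quotient_algebra M I\<^esub> a) = c * \<epsilon> a"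
    if a: "a \<in> carrier (quotient_algebra M I)" for c a
  proof -
    obtain x where x: "x \<in> carrier M" "a = I +>\<^bsub>M\<^esub> x"
      using cosets[OF a] by blast
    have "h ` (c \<odot>\<^bsub>quotient_algebra M I\<^esub> a) = (\<Union>y\<in>a. h ` (I +>\<^bsub>M\<^esub> (c \<odot>\<^bsub>M\<^esub> y)))"
      by (simp add: quotient_algebra_def image_UN)
    also have "\<dots> = (\<Union>y\<in>a. {c * h x})"
    proof (rule SUP_cong)
      fix y assume "y \<in> a"
      then have "y \<in> carrier M" "h y = h x"
        using x coset_subset const by auto
      then show "h ` (I +>\<^bsub>M\<^esub> (c \<odot>\<^bsub>M\<^esub> y)) = {c * h x}"
        by (simp add: image smult_closed smult)
    qed simp
    also have "\<dots> = {c * h x}"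
      using self[OF x(1)] x(2) by auto
    finally show ?thesis
      using x by (simp add: eval) (simp add: \<epsilon>_def)
  qed
  with hom show "is_character (quotient_algebra M I) \<epsilon>"
    by (simp add: is_character_def)
qed

section \<open>The augmentation of the candidate algebra\<close>

lemma constant_term_ring_hom:
  "(\<lambda>f. Poly_Mapping.lookup f 0) \<in>
     ring_hom (free_algebra N) (ring_of_type_algebra :: ratfun ring)"
  by (rule ring_hom_memI)
    (simp_all add: ring_of_type_algebra_def lookup_0_mult_free_monoid lookup_add lookup_one)

text \<open>The ideal through which all the relations are seen to have constant term 0.\<close>

lemma ideal_augmentation:
  "ideal {f \<in> carrier (free_algebra N). Poly_Mapping.lookup f 0 = 0} (free_algebra N)"
proof (rule idealI)
  interpret ring "free_algebra N" by (rule ring_free_algebra)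
  show "subgroup {f \<in> carrier (free_algebra N). Poly_Mapping.lookup f 0 = 0}
      (add_monoid (free_algebra N))"
  proof (rule add.subgroupI)
    fix f assume f: "f \<in> {f \<in> carrier (free_algebra N). Poly_Mapping.lookup f 0 = 0}"
    then have "\<ominus>\<^bsub>free_algebra N\<^esub> f = - f"
      by (intro minus_equality) (simp_all add: free_algebra_closed)
    with f show "\<ominus>\<^bsub>free_algebra N\<^esub> f \<in> {f \<in> carrier (free_algebra N). Poly_Mapping.lookup f 0 = 0}"
      by (simp add: free_algebra_closed)
  qed (auto simp: free_algebra_closed lookup_add intro: zero_closed_free_algebra)
qed (simp_all add: ring_free_algebra free_algebra_closed lookup_0_mult_free_monoid)

lemma ideal_relation_ideal_and_constant_term:
  assumes "admissible S Or P"
  shows "ideal (relation_ideal S P) (free_algebra (num_curves P))"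
    and "f \<in> relation_ideal S P \<Longrightarrow> Poly_Mapping.lookup f 0 = 0"
proof -
  define N where "N = num_curves P"
  define \<iota> where "\<iota> = curve_matrix S P"
  define G where "G =
    {T_word \<iota> (the_relator P l) (Xgen i) - Xgen i | i l. i \<in> {1..N} \<and> l \<in> {1..num_relators P}} \<union>
    {T \<iota> j 1 (T \<iota> j (-1) (Xgen i)) - Xgen i | i j. i \<in> {1..N} \<and> j \<in> {1..N}} \<union>
    {Xgen i * Xgen j - Xgen j * Xgen i | i j. i \<in> {1..N} \<and> j \<in> {1..N} \<and> \<iota> i j = 0}"
  have rel: "relation_ideal S P = genideal (free_algebra N) G"
    by (simp add: relation_ideal_def Let_def G_def N_def \<iota>_def)
  have "the_relator P l \<in> gwords N" if "l \<in> {1..num_relators P}" for l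
    using assms that by (simp add: admissible_def Let_def N_def)
  then have G: "G \<subseteq> {f \<in> carrier (free_algebra N). Poly_Mapping.lookup f 0 = 0}"
    unfolding G_def
    by (auto simp: lookup_minus lookup_0_T lookup_0_T_word lookup_0_mult_free_monoid
        intro!: diff_closed_free_algebra mult_closed_free_algebra T_word_closed T_closed Xgen_closed)
  interpret ring "free_algebra N" by (rule ring_free_algebra)
  show "ideal (relation_ideal S P) (free_algebra (num_curves P))"
    using G unfolding rel N_def[symmetric] by (intro genideal_ideal) auto
  show "Poly_Mapping.lookup f 0 = 0" if "f \<in> relation_ideal S P"
    using that genideal_minimal[OF ideal_augmentation G] unfolding rel by blast
qed

theorem lemma3p11:
  fixes S :: "'a topology" and Or :: "'a atlas" and g :: nat and P :: "'a presentation_datum"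
  assumes "surface S" and "compact_space S" and "connected_space S" and "orientation S Or"
    and "genus S = g" and "g \<ge> 3"
    and "finite (boundary_components S)" and "card (boundary_components S) \<in> {0, 1}"
    and "admissible S Or P"
  shows "\<exists>\<epsilon>\<^sub>a\<^sub>u\<^sub>g. is_character (candidate_algebra S P) \<epsilon>\<^sub>a\<^sub>u\<^sub>g \<and>
           (\<forall>i\<in>{1..num_curves P}. \<epsilon>\<^sub>a\<^sub>u\<^sub>g (generator_class S P i) = 0)"
proof -
  note I = ideal_relation_ideal_and_constant_term[OF \<open>admissible S Or P\<close>]
  obtain \<epsilon> where "is_character (candidate_algebra S P) \<epsilon>"
    and "\<And>f. f \<in> carrier (free_algebra (num_curves P)) \<Longrightarrow>
      \<epsilon> (relation_ideal S P +>\<^bsub>free_algebra (num_curves P)\<^esub> f) = Poly_Mapping.lookup f 0"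
    unfolding candidate_algebra_def
    by (rule character_of_quotient_algebra[OF I(1) constant_term_ring_hom])
      (simp_all add: I(2) free_algebra_closed lookup_0_mult_free_monoid)
  then show ?thesis
    by (intro exI[of _ \<epsilon>]) (simp add: generator_class_def Xgen_closed)
qed

end
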